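(* For a real constant $u>1$, let $\bar{\mathbf{x}}_{\mathrm{IO}}(u)=\tilde{\mathbf{x}}(\boldsymbol\theta_u,u)$, where $\boldsymbol\theta_u:=\left(1/\sqrt{1+u^2},\,u/\sqrt{1+u^2}\right)$, i.e. the policy that samples uniformly at random from the set of optimal solutions of $\mathbf{FO}(\boldsymbol\theta_u,u)$. For any $v\in\mathbb{R}_+$ there exists some $\bar u>1$ such that $\mathrm{AOG}(\bar{\mathbf{x}}_{\mathrm{IO}})>v$ and $\mathrm{POG}(\bar{\mathbf{x}}_{\mathrm{IO}})>v$ for any $u>\bar u$.
   Context: For $u>1$ and $\boldsymbol\theta\in\mathbb{R}^2$, $\mathbf{FO}(\boldsymbol\theta,u)$ is the linear program: minimize $f(\boldsymbol\theta,\mathbf{x})=\theta_1x_1+\theta_2x_2$ over $\mathbf{x}=(x_1,x_2)$ subject to $x_1+ux_2\ge u$, $0\le x_1\le u$, $0\le x_2\le2$. $\tilde{\mathbf{x}}(\boldsymbol\theta,u)$ denotes an optimal solution drawn uniformly at random from the set of optimal solutions of $\mathbf{FO}(\boldsymbol\theta,u)$. The exogenous parameter is deterministic and equal to $u$. The ground-truth parameter is $\boldsymbol\theta^*=(\cos(\pi/4),\sin(\pi/4))$. The perceived parameter $\hat{\boldsymbol\theta}$ is uniformly distributed on $\boldsymbol\Theta=\{(\cos\delta,\sin\delta)\mid\delta\in(0,\pi/2)\}$ (and is independent of the random draw of the policy). For a (possibly randomized) policy $\bar{\mathbf{x}}$, $\mathrm{AOG}(\bar{\mathbf{x}}):=\mathbb{E}[f(\boldsymbol\theta^*,\bar{\mathbf{x}}(u))-f(\boldsymbol\theta^*,\tilde{\mathbf{x}}(\boldsymbol\theta^*,u))]$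 and $\mathrm{POG}(\bar{\mathbf{x}}):=\mathbb{E}[f(\hat{\boldsymbol\theta},\bar{\mathbf{x}}(u))-f(\hat{\boldsymbol\theta},\tilde{\mathbf{x}}(\hat{\boldsymbol\theta},u))]$, with expectations over $\hat{\boldsymbol\theta}$ and the randomness of the policy. *)

theory Defs
  imports "HOL-Probability.Probability"
begin

definition obj :: "real \<times> real \<Rightarrow> real \<times> real \<Rightarrow> real" where
  "obj \<theta> x = fst \<theta> * fst x + snd \<theta> * snd x"

definition feasible :: "real \<Rightarrow> (real \<times> real) set" where
  "feasible u = {(x1, x2). x1 + u * x2 \<ge> u \<and> 0 \<le> x1 \<and> x1 \<le> u \<and> 0 \<le> x2 \<and> x2 \<le> 2}"

definition opt_set :: "real \<times> real \<Rightarrow> real \<Rightarrow> (real \<times> real) set" where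
  "opt_set \<theta> u = {x. is_arg_min (obj \<theta>) (\<lambda>x. x \<in> feasible u) x}"

text \<open>The uniform distribution on a nonempty compact convex subset of the plane, taken with respect
  to the measure of the dimension of the set: a point mass, the normalized length of a segment, or
  the normalized area. Optimal sets of linear programs over a bounded polygon fall under all three
  cases. The choice of the end points of the segment is immaterial, see
  \<open>uniform_dist_closed_segment\<close> below.\<close>

definition segment_dist :: "real \<times> real \<Rightarrow> real \<times> real \<Rightarrow> (real \<times> real) measure" where
  "segment_dist a b = distr (uniform_measure lborel {0..1}) borel (\<lambda>t. (1 - t) *\<^sub>R a + t *\<^sub>R b)"

definition uniform_dist :: "(real \<times> real) set \<Rightarrow> (real \<times> real) measure" where
  "uniform_dist S =
    (if aff_dim S = 0 then return borel (THE a. S = {a})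
     else if aff_dim S = 1 then (let (a, b) = (SOME (a, b). S = closed_segment a b) in segment_dist a b)
     else uniform_measure lborel S)"

text \<open>Randomized decisions are represented by their laws, and a randomized policy by the map
  taking the exogenous parameter to the law of the decision.\<close>

definition x_tilde :: "real \<times> real \<Rightarrow> real \<Rightarrow> (real \<times> real) measure" where
  "x_tilde \<theta> u = uniform_dist (opt_set \<theta> u)"

definition theta_star :: "real \<times> real" where
  "theta_star = (cos (pi / 4), sin (pi / 4))"

text \<open>The angle is the arc length parameter of the open quarter circle, so a uniform
  angle gives the uniform distribution on the arc.\<close>

definition theta_hat :: "(real \<times> real) measure" where
  "theta_hat = distr (uniform_measure lborel {0<..<pi / 2}) borel (\<lambda>\<delta>. (cos \<delta>, sin \<delta>))"

definition AOG :: "(real \<Rightarrow> (real \<times> real) measure) \<Rightarrow> real \<Rightarrow> real" where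
  "AOG xbar u =
    (\<integral>x. (\<integral>y. obj theta_star x - obj theta_star y \<partial>x_tilde theta_star u) \<partial>xbar u)"

text \<open>The product measure expresses the independence of the perceived parameter and the draw of the
  policy; the inner integral is over the optimal solution drawn given the perceived parameter.\<close>

definition POG :: "(real \<Rightarrow> (real \<times> real) measure) \<Rightarrow> real \<Rightarrow> real" where
  "POG xbar u =
    (\<integral>(\<theta>, x). (\<integral>y. obj \<theta> x - obj \<theta> y \<partial>x_tilde \<theta> u) \<partial>(theta_hat \<Otimes>\<^sub>M xbar u))"

definition theta_IO :: "real \<Rightarrow> real \<times> real" where
  "theta_IO u = (1 / sqrt (1 + u\<^sup>2), u / sqrt (1 + u\<^sup>2))"

definition x_IO :: "real \<Rightarrow> (real \<times> real) measure" where
  "x_IO u = x_tilde (theta_IO u) u"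

lemma segment_dist_commute: "segment_dist a b = segment_dist b a"
proof -
  let ?U = "uniform_measure lborel {0..1::real}"
  have refl: "distr ?U borel (\<lambda>t. 1 - t) = ?U"
  proof (rule measure_eqI)
    fix A assume "A \<in> sets (distr ?U borel (\<lambda>t::real. 1 - t))"
    then have A: "A \<in> sets borel" by simp
    let ?V = "(\<lambda>t::real. 1 - t) -` A"
    have V: "?V \<in> sets borel"
      using measurable_sets[of "\<lambda>t::real. 1 - t" borel borel A] A by simp
    have "emeasure lborel ({0..1} \<inter> ?V) = emeasure lborel ((\<lambda>t. 1 - t) -` ({0..1} \<inter> A))"
      by (rule arg_cong[where f = "emeasure lborel"]) auto
    also have "\<dots> = emeasure (distr lborel borel (\<lambda>t::real. 1 - t)) ({0..1} \<inter> A)"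
      using A by (subst emeasure_distr) auto
    also have "distr lborel borel (\<lambda>t::real. 1 - t) = lborel"
      using lborel_real_affine[of "-1" 1] by (simp add: density_1)
    finally show "emeasure (distr ?U borel (\<lambda>t. 1 - t)) A = emeasure ?U A"
      using A V by (subst emeasure_distr) (auto simp: emeasure_uniform_measure)
  qed simp
  have "segment_dist a b = distr (distr ?U borel (\<lambda>t. 1 - t)) borel (\<lambda>t. (1 - t) *\<^sub>R a + t *\<^sub>R b)"
    by (simp add: segment_dist_def refl)
  also have "\<dots> = segment_dist b a"
    by (subst distr_distr) (auto simp: segment_dist_def comp_def add.commute)
  finally show ?thesis .
qed

lemma uniform_dist_singleton: "uniform_dist {a} = return borel a"
  by (simp add: uniform_dist_def)

lemma uniform_dist_closed_segment:
  assumes "a \<noteq> b"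
  shows "uniform_dist (closed_segment a b) = segment_dist a b"
proof -
  obtain c d where cd: "(SOME (c, d). closed_segment a b = closed_segment c d) = (c, d)"
    by (metis surj_pair)
  have "case (SOME (c, d). closed_segment a b = closed_segment c d) of
      (c, d) \<Rightarrow> closed_segment a b = closed_segment c d"
    by (rule someI[of _ "(a, b)"]) simp
  with cd have "{a, b} = {c, d}"
    by (simp add: closed_segment_eq)
  then have "segment_dist c d = segment_dist a b"
    by (metis doubleton_eq_iff segment_dist_commute)
  moreover have "aff_dim (closed_segment a b) = 1"
    using assms by (simp add: segment_convex_hull aff_dim_convex_hull aff_dim_2)
  ultimately show ?thesis
    unfolding uniform_dist_def cd by simp
qed

end

(* At theta = (cos d, sin d) the two end points (0,1) and (u,0) of the optimal edge for theta_u have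
   objective values sin d and u cos d, and the optimal value is at most sin d. A uniform point of the
   edge has mean value (sin d + u cos d) / 2, so its gap is at least (u cos d - sin d) / 2. This is
   (u - 1) / (2 sqrt 2) at d = pi/4, and its average over the quarter circle is (u - 1) / pi. *)

theory Submission
  imports Defs
begin

section \<open>The objective and its minimum over the feasible polygon\<close>

lemma obj_eq_inner: "obj \<theta> x = \<theta> \<bullet> x"
  by (simp add: obj_def inner_prod_def)

text \<open>The minimum over the vertices (0, 1), (u, 0), (u, 2), (0, 2). It has to be known for all
  parameters, not only positive ones, since the gap in \<open>POG\<close> must be measurable on the whole
  plane.\<close>

definition min_obj :: "real \<times> real \<Rightarrow> real \<Rightarrow> real" where
  "min_obj \<theta> u =
    min (min (snd \<theta>) (u * fst \<theta>)) (min (u * fst \<theta> + 2 * snd \<theta>) (2 * snd \<theta>))"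

lemma borel_measurable_obj [measurable]:
  "(\<lambda>(\<theta>, x). obj \<theta> x) \<in> borel_measurable (borel \<Otimes>\<^sub>M borel)"
  unfolding obj_eq_inner borel_prod split_def
  by (intro borel_measurable_continuous_onI continuous_intros)

lemma borel_measurable_obj_right [measurable]: "obj \<theta> \<in> borel_measurable borel"
  unfolding obj_eq_inner by measurable

lemma borel_measurable_min_obj [measurable]: "(\<lambda>\<theta>. min_obj \<theta> u) \<in> borel_measurable borel"
  unfolding min_obj_def
  by (intro borel_measurable_continuous_onI continuous_intros)

lemma min_le_convex_combination:
  fixes a b t :: real
  assumes "0 \<le> t" "t \<le> 1"
  shows "min a b \<le> (1 - t) * a + t * b"
proof -
  have "min a b = (1 - t) * min a b + t * min a b"
    by (simp add: algebra_simps)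
  also have "\<dots> \<le> (1 - t) * a + t * b"
    using assms by (intro add_mono mult_left_mono) auto
  finally show ?thesis .
qed

text \<open>Put t = x1 / u, so that the constraints read 1 - t \<le> x2 \<le> 2. If
  \<open>snd \<theta>\<close> is nonnegative, lowering x2 to 1 - t moves the point to the edge from
  (0, 1) to (u, 0) without raising the objective; otherwise raising x2 to 2 moves it to the top
  edge. On either edge the objective is the convex combination, with weight t, of the values at the
  two end points.\<close>

lemma min_obj_le:
  assumes u: "u > 0" and x: "x \<in> feasible u"
  shows "min_obj \<theta> u \<le> obj \<theta> x"
proof -
  define t where "t = fst x / u"
  have t: "0 \<le> t" "t \<le> 1" and x1: "fst x = u * t"
    using u x by (auto simp: t_def feasible_def)
  have x2: "1 - t \<le> snd x" "snd x \<le> 2"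
  proof -
    have "u * (1 - t) \<le> u * snd x"
      using x x1 by (auto simp: feasible_def algebra_simps)
    then show "1 - t \<le> snd x"
      using u by simp
  qed (use x in \<open>auto simp: feasible_def\<close>)
  show ?thesis
  proof (cases "snd \<theta> \<ge> 0")
    case True
    have "min_obj \<theta> u \<le> (1 - t) * snd \<theta> + t * (u * fst \<theta>)"
      using min_le_convex_combination[OF t, of "snd \<theta>" "u * fst \<theta>"]
      by (simp add: min_obj_def)
    also have "\<dots> \<le> obj \<theta> x"
      using mult_left_mono[OF x2(1) True] by (simp add: obj_def x1 algebra_simps)
    finally show ?thesis .
  next
    case False
    have "min_obj \<theta> u \<le> (1 - t) * (2 * snd \<theta>) + t * (u * fst \<theta> + 2 * snd \<theta>)"
      using min_le_convex_combination[OF t, of "2 * snd \<theta>" "u * fst \<theta> + 2 * snd \<theta>"]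
      by (simp add: min_obj_def)
    also have "\<dots> \<le> obj \<theta> x"
      using mult_left_mono_neg[OF x2(2), of "snd \<theta>"] False by (simp add: obj_def x1 algebra_simps)
    finally show ?thesis .
  qed
qed

lemma min_obj_attained:
  assumes "u > 0"
  shows "\<exists>x \<in> feasible u. obj \<theta> x = min_obj \<theta> u"
proof -
  have "{(0, 1), (u, 0), (u, 2), (0, 2)} \<subseteq> feasible u"
    using assms by (auto simp: feasible_def)
  moreover have "\<exists>x \<in> {(0, 1), (u, 0), (u, 2), (0, 2)}. obj \<theta> x = min_obj \<theta> u"
    by (auto simp: obj_def min_obj_def min_def algebra_simps)
  ultimately show ?thesis
    by blast
qed

section \<open>Shape of the optimal sets\<close>

lemma opt_set_eq:
  assumes "u > 0"
  shows "opt_set \<theta> u = {x \<in> feasible u. obj \<theta> x = min_obj \<theta> u}"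
proof (intro set_eqI iffI)
  fix x
  assume "x \<in> opt_set \<theta> u"
  then have x: "x \<in> feasible u" "\<And>y. y \<in> feasible u \<Longrightarrow> obj \<theta> x \<le> obj \<theta> y"
    by (auto simp: opt_set_def is_arg_min_def not_less)
  with min_obj_attained[OF assms, of \<theta>] min_obj_le[OF assms x(1), of \<theta>]
  show "x \<in> {x \<in> feasible u. obj \<theta> x = min_obj \<theta> u}"
    by force
next
  fix x
  assume "x \<in> {x \<in> feasible u. obj \<theta> x = min_obj \<theta> u}"
  then show "x \<in> opt_set \<theta> u"
    using min_obj_le[OF assms, of _ \<theta>] by (force simp: opt_set_def is_arg_min_def not_less)
qed

lemma feasible_eq:
  "feasible u = cbox (0, 0) (u, 2) \<inter> {x. (1, u) \<bullet> x \<ge> u}"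
  by (auto simp: feasible_def cbox_Pair_eq)

text \<open>The optimal set is a box cut by a half-plane and a level set of the objective. Together
  with \<open>collinear_opt_set\<close> this makes it a point or a segment for every nonzero
  \<theta>, so the area case of \<open>uniform_dist\<close> arises only at \<theta> = 0.\<close>

lemma opt_set_compact_convex:
  assumes "u > 0"
  shows "compact (opt_set \<theta> u)" "convex (opt_set \<theta> u)" "opt_set \<theta> u \<noteq> {}"
proof -
  have eq: "opt_set \<theta> u =
      cbox (0, 0) (u, 2) \<inter> ({x. (1, u) \<bullet> x \<ge> u} \<inter> {x. \<theta> \<bullet> x = min_obj \<theta> u})"
    by (auto simp: opt_set_eq[OF assms] feasible_eq obj_eq_inner)
  show "compact (opt_set \<theta> u)"
    unfolding eq
    by (intro compact_Int_closed compact_cbox closed_Int closed_halfspace_ge closed_hyperplane)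
  show "convex (opt_set \<theta> u)"
    unfolding eq
    by (intro convex_Int convex_box convex_halfspace_ge convex_hyperplane)
  show "opt_set \<theta> u \<noteq> {}"
    using min_obj_attained[OF assms, of \<theta>] by (auto simp: opt_set_eq[OF assms])
qed

lemma collinear_opt_set:
  assumes "u > 0" "\<theta> \<noteq> 0"
  shows "collinear (opt_set \<theta> u)"
proof -
  have "opt_set \<theta> u \<subseteq> {x. \<theta> \<bullet> x = min_obj \<theta> u}"
    by (auto simp: opt_set_eq[OF assms(1)] obj_eq_inner)
  moreover have "collinear {x. \<theta> \<bullet> x = min_obj \<theta> u}"
    using assms(2) by (simp add: collinear_aff_dim)
  ultimately show ?thesis
    by (rule collinear_subset[rotated])
qed

section \<open>Uniform laws on segments and the value of an optimal draw\<close>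

lemma prob_space_unit_interval: "prob_space (uniform_measure lborel {0..1::real})"
  by (rule prob_space_uniform_measure) auto

lemma prob_space_segment_dist: "prob_space (segment_dist a b)"
  unfolding segment_dist_def
  by (rule prob_space.prob_space_distr[OF prob_space_unit_interval]) measurable

lemma sets_segment_dist [measurable_cong, simp]: "sets (segment_dist a b) = sets borel"
  by (simp add: segment_dist_def)

lemma AE_segment_dist: "AE x in segment_dist a b. x \<in> closed_segment a b"
proof -
  have "AE t in uniform_measure lborel {0..1}. (1 - t) *\<^sub>R a + t *\<^sub>R b \<in> closed_segment a b"
    by (rule AE_uniform_measureI) (auto simp: closed_segment_def)
  then show ?thesis
    unfolding segment_dist_def
    by (subst AE_distr_iff) (auto intro!: borel_closed closed_segment)
qed

text \<open>Such a set is a closed segment, possibly degenerate, so its uniform law is a point mass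
  or a \<open>segment_dist\<close>.\<close>

lemma uniform_dist_compact_convex_collinear:
  fixes S :: "(real \<times> real) set"
  assumes "compact S" "convex S" "collinear S" "S \<noteq> {}"
  shows "prob_space (uniform_dist S)" "sets (uniform_dist S) = sets borel"
    "AE x in uniform_dist S. x \<in> S"
proof -
  obtain a b where S: "S = closed_segment a b"
    using compact_convex_collinear_segment[of S] assms by metis
  have "prob_space (uniform_dist S) \<and> sets (uniform_dist S) = sets borel \<and>
      (AE x in uniform_dist S. x \<in> S)"
  proof (cases "a = b")
    case True
    then have "S = {b}"
      by (simp add: S)
    moreover have "AE x in return borel b. x \<in> {b}"
      by (subst AE_return) (auto simp: pred_def)
    ultimately show ?thesis
      unfolding \<open>S = {b}\<close> uniform_dist_singleton by (auto intro!: prob_space_return)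
  next
    case False
    then show ?thesis
      unfolding S uniform_dist_closed_segment[OF False]
      by (simp add: prob_space_segment_dist AE_segment_dist)
  qed
  then show "prob_space (uniform_dist S)" "sets (uniform_dist S) = sets borel"
    "AE x in uniform_dist S. x \<in> S"
    by auto
qed

text \<open>A draw from the optimal set almost surely has objective value
  \<open>min_obj \<theta> u\<close>, so the integrand is almost surely constant. At \<theta> = 0
  both sides vanish.\<close>

lemma integral_obj_x_tilde:
  assumes "u > 0"
  shows "(\<integral>y. obj \<theta> x - obj \<theta> y \<partial>x_tilde \<theta> u) = obj \<theta> x - min_obj \<theta> u"
proof (cases "\<theta> = 0")
  case True
  then show ?thesis
    by (simp add: obj_def min_obj_def)
next
  case False
  note props = uniform_dist_compact_convex_collinear[OF opt_set_compact_convex(1,2)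
      collinear_opt_set opt_set_compact_convex(3), OF assms assms assms False assms]
  interpret prob_space "x_tilde \<theta> u"
    using props(1) by (simp add: x_tilde_def)
  have [measurable_cong]: "sets (x_tilde \<theta> u) = sets borel"
    using props(2) by (simp add: x_tilde_def)
  have "AE y in x_tilde \<theta> u. obj \<theta> y = min_obj \<theta> u"
    unfolding x_tilde_def using props(3)
    by (rule eventually_mono) (auto simp: opt_set_eq[OF assms])
  then have "(\<integral>y. obj \<theta> x - obj \<theta> y \<partial>x_tilde \<theta> u) =
      (\<integral>y. obj \<theta> x - min_obj \<theta> u \<partial>x_tilde \<theta> u)"
    by (intro integral_cong_AE) auto
  also have "\<dots> = obj \<theta> x - min_obj \<theta> u"
    using prob_space by simp
  finally show ?thesis .
qed

section \<open>The law of the policy\<close>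

text \<open>\<open>theta_IO u\<close> is the unit normal of the constraint x1 + u x2 \<ge> u. The
  objective is therefore a positive multiple of the left-hand side, and the optimal points are the
  feasible points where this constraint is tight.\<close>

lemma opt_set_theta_IO:
  assumes "u > 0"
  shows "opt_set (theta_IO u) u = closed_segment (0, 1) (u, 0)"
proof -
  define c where "c = 1 / sqrt (1 + u\<^sup>2)"
  have c: "c > 0"
    unfolding c_def by (simp add: add_pos_nonneg)
  have \<theta>: "theta_IO u = (c, u * c)"
    by (simp add: theta_IO_def c_def)
  have "min_obj (theta_IO u) u = u * c"
    using assms c by (simp add: \<theta> min_obj_def)
  moreover have "obj (theta_IO u) x = c * (fst x + u * snd x)" for x
    by (simp add: \<theta> obj_def algebra_simps)
  ultimately have "opt_set (theta_IO u) u = {x \<in> feasible u. fst x + u * snd x = u}"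
    using c by (simp add: opt_set_eq[OF assms] mult.commute[of u c])
  also have "\<dots> = closed_segment (0, 1) (u, 0)"
  proof (intro set_eqI iffI)
    fix x
    assume "x \<in> {x \<in> feasible u. fst x + u * snd x = u}"
    then have "x = (1 - fst x / u) *\<^sub>R (0, 1) + (fst x / u) *\<^sub>R (u, 0)" "0 \<le> fst x / u" "fst x / u \<le> 1"
      using assms by (auto simp: feasible_def prod_eq_iff field_simps)
    then show "x \<in> closed_segment (0, 1) (u, 0)"
      unfolding closed_segment_def by blast
  next
    fix x :: "real \<times> real"
    assume "x \<in> closed_segment (0, 1) (u, 0)"
    then obtain t where "0 \<le> t" "t \<le> 1" "x = (t * u, 1 - t)"
      by (auto simp: closed_segment_def)
    then show "x \<in> {x \<in> feasible u. fst x + u * snd x = u}"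
      using assms by (simp add: feasible_def algebra_simps mult_left_le)
  qed
  finally show ?thesis .
qed

lemma x_IO_eq:
  assumes "u > 0"
  shows "x_IO u = segment_dist (0, 1) (u, 0)"
  by (simp add: x_IO_def x_tilde_def opt_set_theta_IO[OF assms] uniform_dist_closed_segment)

section \<open>Means under the uniform laws\<close>

text \<open>Turns a mean under a uniform law into a Lebesgue integral over the set, to which the
  fundamental theorem of calculus applies when the set is an interval.\<close>

lemma integral_uniform_measure_lborel:
  fixes f :: "real \<Rightarrow> real"
  assumes [measurable]: "A \<in> sets borel" "f \<in> borel_measurable borel"
    and c: "emeasure lborel A = ennreal c" "c > 0"
  shows "(\<integral>x. f x \<partial>uniform_measure lborel A) = (LBINT x:A. f x) / c"
proof -
  have "uniform_measure lborel A = density lborel (\<lambda>x. ennreal (indicator A x / c))"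
    unfolding uniform_measure_def c
    by (intro arg_cong[where f = "density lborel"] ext)
      (auto simp: indicator_def divide_ennreal c(2) simp flip: ennreal_1)
  then have "(\<integral>x. f x \<partial>uniform_measure lborel A) = (\<integral>x. (indicator A x / c) *\<^sub>R f x \<partial>lborel)"
    using c(2) by (simp add: integral_density)
  also have "\<dots> = (\<integral>x. (indicator A x *\<^sub>R f x) / c \<partial>lborel)"
    by simp
  finally show ?thesis
    by (simp add: set_lebesgue_integral_def)
qed

text \<open>The objective is affine along the segment and both weights t and 1 - t have mean 1/2 on
  the unit interval.\<close>

lemma integral_segment_dist_obj:
  "(\<integral>x. obj \<theta> x \<partial>segment_dist a b) = (obj \<theta> a + obj \<theta> b) / 2"
proof -
  have "(\<integral>x. obj \<theta> x \<partial>segment_dist a b) =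
      (\<integral>t. (1 - t) * obj \<theta> a + t * obj \<theta> b \<partial>uniform_measure lborel {0..1})"
    unfolding segment_dist_def
    by (subst integral_distr) (auto simp: obj_eq_inner inner_add_right)
  also have "\<dots> = (LBINT t:{0..1}. (1 - t) * obj \<theta> a + t * obj \<theta> b)"
    by (subst integral_uniform_measure_lborel[where c = 1]) auto
  also have "\<dots> = (LBINT t=0..1. (1 - t) * obj \<theta> a + t * obj \<theta> b)"
    by (simp add: zero_ereal_def one_ereal_def interval_integral_Icc)
  also have "\<dots> = (\<lambda>t. (t - t\<^sup>2 / 2) * obj \<theta> a + t\<^sup>2 / 2 * obj \<theta> b) 1 -
      (\<lambda>t. (t - t\<^sup>2 / 2) * obj \<theta> a + t\<^sup>2 / 2 * obj \<theta> b) 0"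
    unfolding zero_ereal_def one_ereal_def
    by (rule interval_integral_FTC_finite)
      (auto intro!: continuous_intros derivative_eq_intros
        simp flip: has_real_derivative_iff_has_vector_derivative)
  finally show ?thesis
    by (simp add: field_simps)
qed

lemma prob_space_theta_hat: "prob_space theta_hat"
  unfolding theta_hat_def
  by (intro prob_space.prob_space_distr prob_space_uniform_measure) auto

lemma sets_theta_hat [measurable_cong, simp]: "sets theta_hat = sets borel"
  by (simp add: theta_hat_def)

lemma AE_theta_hat: "AE \<theta> in theta_hat. norm \<theta> = 1"
  unfolding theta_hat_def by (subst AE_distr_iff) (auto simp: norm_Pair)

lemma integral_theta_hat:
  "(\<integral>\<theta>. u * fst \<theta> - snd \<theta> \<partial>theta_hat) = 2 * (u - 1) / pi"
proof -
  have [measurable]: "(\<lambda>\<theta> :: real \<times> real. u * fst \<theta> - snd \<theta>) \<in> borel_measurable borel"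
    by (intro borel_measurable_continuous_onI continuous_intros)
  have "(\<integral>\<theta>. u * fst \<theta> - snd \<theta> \<partial>theta_hat) =
      (\<integral>\<delta>. u * cos \<delta> - sin \<delta> \<partial>uniform_measure lborel {0<..<pi / 2})"
    unfolding theta_hat_def by (subst integral_distr) auto
  also have "\<dots> = (LBINT \<delta>:{0<..<pi / 2}. u * cos \<delta> - sin \<delta>) / (pi / 2)"
    by (rule integral_uniform_measure_lborel) auto
  also have "(LBINT \<delta>:{0<..<pi / 2}. u * cos \<delta> - sin \<delta>) =
      (LBINT \<delta>=ereal 0..ereal (pi / 2). u * cos \<delta> - sin \<delta>)"
    by (subst interval_integral_Ioo) auto
  \<comment> \<open>The antiderivative is u at pi / 2 and 1 at 0; dividing the difference u - 1 by
    the length pi / 2 gives the claim.\<close>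
  also have "\<dots> = (\<lambda>\<delta>. u * sin \<delta> + cos \<delta>) (pi / 2) - (\<lambda>\<delta>. u * sin \<delta> + cos \<delta>) 0"
    by (rule interval_integral_FTC_finite)
      (auto intro!: continuous_intros derivative_eq_intros
        simp flip: has_real_derivative_iff_has_vector_derivative)
  finally show ?thesis
    by (simp add: field_simps)
qed

section \<open>Lower bounds for the two gaps\<close>

lemma AE_x_IO:
  assumes "u > 0"
  shows "AE x in x_IO u. norm x \<le> 1 + u"
proof -
  have "closed_segment (0, 1) (u, 0) \<subseteq> cball (0 :: real \<times> real) (1 + u)"
    using assms by (intro closed_segment_subset) (auto simp: norm_Pair)
  then show ?thesis
    unfolding x_IO_eq[OF assms]
    by (intro eventually_mono[OF AE_segment_dist]) auto
qed

lemma integral_obj_x_IO: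
  assumes "u > 0"
  shows "(\<integral>x. obj \<theta> x - c \<partial>x_IO u) = (snd \<theta> + u * fst \<theta>) / 2 - c"
proof -
  interpret prob_space "x_IO u"
    by (simp add: x_IO_eq[OF assms] prob_space_segment_dist)
  have [measurable_cong]: "sets (x_IO u) = sets borel"
    by (simp add: x_IO_eq[OF assms])
  \<comment> \<open>Boundedness gives integrability, which is what allows the constant c to be split
    off the integral.\<close>
  have "AE x in x_IO u. norm (obj \<theta> x) \<le> norm \<theta> * (1 + u)"
    using AE_x_IO[OF assms]
  proof eventually_elim
    case (elim x)
    then show ?case
      using Cauchy_Schwarz_ineq2[of \<theta> x] mult_left_mono[of "norm x" "1 + u" "norm \<theta>"]
      by (simp add: obj_eq_inner)
  qed
  then have "integrable (x_IO u) (obj \<theta>)"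
    by (rule integrable_const_bound) measurable
  then have "(\<integral>x. obj \<theta> x - c \<partial>x_IO u) = (\<integral>x. obj \<theta> x \<partial>x_IO u) - c"
    by (simp add: prob_space)
  also have "(\<integral>x. obj \<theta> x \<partial>x_IO u) = (snd \<theta> + u * fst \<theta>) / 2"
    by (simp add: x_IO_eq[OF assms] integral_segment_dist_obj) (simp add: obj_def)
  finally show ?thesis .
qed

lemma AOG_x_IO_ge:
  assumes "u > 0"
  shows "(u - 1) / (2 * sqrt 2) \<le> AOG x_IO u"
proof -
  have "(u - 1) / (2 * sqrt 2) = (snd theta_star + u * fst theta_star) / 2 - snd theta_star"
    by (simp add: theta_star_def cos_45 sin_45 field_simps)
  \<comment> \<open>The minimum is at most \<open>snd theta_star\<close>, the value at the vertex
    (0, 1).\<close>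
  also have "\<dots> \<le> (snd theta_star + u * fst theta_star) / 2 - min_obj theta_star u"
    by (intro diff_left_mono) (simp add: min_obj_def)
  also have "\<dots> = AOG x_IO u"
    by (simp add: AOG_def integral_obj_x_tilde integral_obj_x_IO assms)
  finally show ?thesis .
qed

lemma abs_min_obj_le:
  assumes "u > 0" "norm \<theta> = 1"
  shows "\<bar>min_obj \<theta> u\<bar> \<le> u + 2"
proof -
  have "\<bar>fst \<theta>\<bar> \<le> 1" "\<bar>snd \<theta>\<bar> \<le> 1"
    using norm_fst_le[of "fst \<theta>" "snd \<theta>"] norm_snd_le[of "snd \<theta>" "fst \<theta>"] assms(2) by auto
  moreover from this have "\<bar>u * fst \<theta>\<bar> \<le> u"
    using assms(1) by (simp add: abs_mult mult_left_le)
  ultimately show ?thesis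
    using assms(1) by (auto simp: min_obj_def min_def)
qed

text \<open>The gap is almost surely bounded, so by Fubini it is the average over
  \<open>theta_hat\<close> of the mean gap at fixed \<theta>. That mean is at least half the
  integrand of \<open>integral_theta_hat\<close>.\<close>

lemma POG_x_IO_ge:
  assumes "u > 0"
  shows "(u - 1) / pi \<le> POG x_IO u"
proof -
  interpret T: prob_space theta_hat
    by (rule prob_space_theta_hat)
  interpret X: prob_space "x_IO u"
    by (simp add: x_IO_eq[OF assms] prob_space_segment_dist)
  interpret P: pair_prob_space theta_hat "x_IO u" ..
  have sets [measurable_cong]: "sets (x_IO u) = sets borel"
    by (simp add: x_IO_eq[OF assms])
  let ?M = "theta_hat \<Otimes>\<^sub>M x_IO u"
  let ?G = "\<lambda>(\<theta>, x). obj \<theta> x - min_obj \<theta> u"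
  \<comment> \<open>On unit vectors \<theta> and points of norm at most 1 + u, Cauchy-Schwarz bounds
    the objective by 1 + u, and the minimum is at most u + 2 in absolute value.\<close>
  have "AE \<theta> in theta_hat. AE x in x_IO u. norm (?G (\<theta>, x)) \<le> (1 + u) + (u + 2)"
    using AE_theta_hat
  proof eventually_elim
    case (elim \<theta>)
    show ?case
      using AE_x_IO[OF assms]
    proof eventually_elim
      case (elim x)
      have "\<bar>obj \<theta> x\<bar> \<le> 1 + u"
        using Cauchy_Schwarz_ineq2[of \<theta> x] elim \<open>norm \<theta> = 1\<close>
        by (simp add: obj_eq_inner)
      with abs_min_obj_le[OF assms \<open>norm \<theta> = 1\<close>] show ?case
        by simp
    qed
  qed
  then have "AE z in ?M. norm (?G z) \<le> (1 + u) + (u + 2)"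
    by (intro P.AE_pair_measure) measurable
  then have G: "integrable ?M ?G"
    by (rule P.integrable_const_bound) measurable
  have "(u - 1) / pi = (\<integral>\<theta>. (u * fst \<theta> - snd \<theta>) / 2 \<partial>theta_hat)"
    using integral_theta_hat[of u] by (simp add: field_simps)
  also have "\<dots> \<le> (\<integral>\<theta>. (\<integral>x. ?G (\<theta>, x) \<partial>x_IO u) \<partial>theta_hat)"
  proof (rule integral_mono)
    show "integrable theta_hat (\<lambda>\<theta>. (u * fst \<theta> - snd \<theta>) / 2)"
    proof (rule T.integrable_const_bound)
      show "AE \<theta> in theta_hat. norm ((u * fst \<theta> - snd \<theta>) / 2) \<le> u + 1"
        using AE_theta_hat
      proof eventually_elim
        case (elim \<theta>)
        have "\<bar>u * fst \<theta>\<bar> \<le> u" "\<bar>snd \<theta>\<bar> \<le> 1"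
          using norm_fst_le[of "fst \<theta>" "snd \<theta>"] norm_snd_le[of "snd \<theta>" "fst \<theta>"] elim assms
          by (auto simp: abs_mult mult_left_le)
        then show ?case
          using assms by auto
      qed
      have "(\<lambda>\<theta> :: real \<times> real. (u * fst \<theta> - snd \<theta>) / 2) \<in> borel_measurable borel"
        by (intro borel_measurable_continuous_onI continuous_intros) auto
      then show "(\<lambda>\<theta>. (u * fst \<theta> - snd \<theta>) / 2) \<in> borel_measurable theta_hat"
        by simp
    qed
    show "integrable theta_hat (\<lambda>\<theta>. \<integral>x. ?G (\<theta>, x) \<partial>x_IO u)"
      by (rule P.integrable_fst'[OF G])
    show "(u * fst \<theta> - snd \<theta>) / 2 \<le> (\<integral>x. ?G (\<theta>, x) \<partial>x_IO u)" for \<theta>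
    proof -
      \<comment> \<open>Comparison with the vertex (0, 1) holds for every \<theta> in the plane, so
        the monotonicity of the integral applies pointwise, not only on the arc.\<close>
      have "min_obj \<theta> u \<le> snd \<theta>"
        by (simp add: min_obj_def)
      then show ?thesis
        by (simp add: integral_obj_x_IO assms field_simps)
    qed
  qed
  also have "\<dots> = integral\<^sup>L ?M ?G"
    by (rule P.integral_fst'[OF G])
  \<comment> \<open>The inner integral over the optimal draw is replaced at every \<theta>, which
    makes the two integrands equal as functions.\<close>
  also have "\<dots> = POG x_IO u"
    by (simp add: POG_def integral_obj_x_tilde assms)
  finally show ?thesis .
qed

theorem proposition1:
  fixes v :: real
  assumes "v \<ge> 0"
  shows "\<exists>ubar>1. \<forall>u>ubar. AOG x_IO u > v \<and> POG x_IO u > v"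
proof (intro exI[of _ "2 + 4 * v"] conjI allI impI)
  \<comment> \<open>The factor 4 exceeds both denominators 2 sqrt 2 and pi, and u > 1 + 4 v already
    gives (u - 1) / 4 > v. The summand 2 in place of 1 keeps the threshold above 1 when v =
    0.\<close>
  show "1 < 2 + 4 * v"
    using assms by simp
  fix u
  assume u: "u > 2 + 4 * v"
  then have "u > 0"
    using assms by simp
  have "v < (u - 1) / 4"
    using u by simp
  also have "\<dots> \<le> (u - 1) / (2 * sqrt 2)"
    using u assms sqrt2_less_2 by (intro divide_left_mono) auto
  also have "\<dots> \<le> AOG x_IO u"
    by (rule AOG_x_IO_ge[OF \<open>u > 0\<close>])
  finally show "AOG x_IO u > v" .
  have "v < (u - 1) / 4"
    using u by simp
  also have "\<dots> \<le> (u - 1) / pi"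
    using u assms pi_less_4 by (intro divide_left_mono) auto
  also have "\<dots> \<le> POG x_IO u"
    by (rule POG_x_IO_ge[OF \<open>u > 0\<close>])
  finally show "POG x_IO u > v" .
qed

end
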